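(* Let $\mathbf t$ be the Thue--Morse word and $h_{\mathbf t}(n)=\frac1n\sum_{i=0}^{n-1}p_{\mathbf t}(i)$ its periodic complexity function. Then for every integer $n\ge 1$, \[ \frac{3n}{8}-\frac14 \le h_{\mathbf t}(n)\le \frac{3n}{4}+2.\] In particular, $h_{\mathbf t}(n)=\Theta(n)$.
   Context: The Thue--Morse word $\mathbf t=t_0t_1t_2\cdots$ over $\{0,1\}$ is defined by $t_i=0$ if the number of $1$'s in the binary representation of $i$ is even, and $t_i=1$ otherwise. For an infinite word $\mathbf w=w_0w_1w_2\cdots$, the periodicity function $p_{\mathbf w}(i)$ is the length of the shortest nonempty prefix $u$ of $w_iw_{i+1}w_{i+2}\cdots$ such that either $u$ is a suffix of $w_0\cdots w_{i-1}$ or $w_0\cdots w_{i-1}$ is a suffix of $u$ (for $i=0$, $w_0\cdots w_{i-1}$ is the empty word); if no such $u$ exists, $p_{\mathbf w}(i)=\infty$ (this does not occur for recurrent words such as $\mathbf t$). *)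

theory Defs
  imports
    Complex_Main
    "HOL-Library.Sublist"
    "HOL-Library.Extended_Real"
    "HOL-Library.Landau_Symbols"
begin

text \<open>Infinite words are functions of type \<open>nat \<Rightarrow> 'a\<close>.\<close>

definition thue_morse :: "nat \<Rightarrow> nat" where
  "thue_morse i = (if even (card {k. bit i k}) then 0 else 1)"

text \<open>The infimum of the empty set of type \<^typ>\<open>enat set\<close> is \<open>\<infinity>\<close>; otherwise the infimum is attained.\<close>

definition periodicity :: "(nat \<Rightarrow> 'a) \<Rightarrow> nat \<Rightarrow> enat" where
  "periodicity w i = Inf {enat (length u) | u l. u = map w [i..<i + l] \<and> u \<noteq> [] \<and>
     (suffix u (map w [0..<i]) \<or> suffix (map w [0..<i]) u)}"

definition periodic_complexity :: "(nat \<Rightarrow> 'a) \<Rightarrow> nat \<Rightarrow> ereal" where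
  "periodic_complexity w n = (\<Sum>i<n. ereal_of_enat (periodicity w i)) / ereal (real n)"

end

theory Submission
  imports Defs
begin

text \<open>
  A shift \<open>l\<close> counts for the periodicity at \<open>i\<close> iff \<open>t j = t (j + l)\<close> whenever \<open>j < i \<le> j + l\<close>.
  Since the letters at \<open>2 m\<close> and \<open>2 m + 1\<close> always differ, at even \<open>i\<close> one of the shifts \<open>1\<close> and
  \<open>2\<close> works. At odd \<open>i\<close> with \<open>2 ^ k \<le> i < 2 ^ (k + 1)\<close> the shift \<open>3 * 2 ^ k\<close> works and is the
  least one: an odd shift would make \<open>t\<close> alternate over five consecutive positions, which forces
  three equal letters in a row, while an even shift \<open>2 l\<close> at \<open>2 i + 1\<close> yields the shift \<open>l\<close> at
  both \<open>i\<close> and \<open>i + 1\<close>, one of which is odd. So odd positions contribute between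
  \<open>3 * (i + 1) / 2\<close> and \<open>3 * i\<close>, even ones at most \<open>2\<close>.
\<close>

section \<open>Periodicity as the least local shift\<close>

definition local_shift :: "(nat \<Rightarrow> 'a) \<Rightarrow> nat \<Rightarrow> nat \<Rightarrow> bool" where
  "local_shift w i l \<longleftrightarrow> l \<ge> 1 \<and> (\<forall>j<i. i \<le> j + l \<longrightarrow> w j = w (j + l))"

lemma local_shiftD: "local_shift w i l \<Longrightarrow> j < i \<Longrightarrow> i \<le> j + l \<Longrightarrow> w (j + l) = w j"
  by (simp add: local_shift_def)

lemma suffix_iff_drop:
  "suffix xs ys \<longleftrightarrow> length xs \<le> length ys \<and> drop (length ys - length xs) ys = xs"
proof
  assume "suffix xs ys"
  then show "length xs \<le> length ys \<and> drop (length ys - length xs) ys = xs"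
    by (auto simp: suffix_def)
next
  assume "length xs \<le> length ys \<and> drop (length ys - length xs) ys = xs"
  then show "suffix xs ys"
    using suffix_drop[of "length ys - length xs" ys] by simp
qed

text \<open>If \<open>l \<le> i\<close>, the second suffix relation forces equal lengths and hence
  implies the first; if \<open>l > i\<close>, only the second is possible. Either way the compared
  pairs are those at distance \<open>l\<close> that straddle the cut before
  \<open>i\<close>.\<close>

lemma suffix_either_iff_local_shift:
  assumes "l \<ge> 1"
  shows "suffix (map w [i..<i + l]) (map w [0..<i]) \<or> suffix (map w [0..<i]) (map w [i..<i + l])
    \<longleftrightarrow> local_shift w i l"
proof (cases "l \<le> i")
  case True
  have "suffix (map w [i..<i + l]) (map w [0..<i]) \<longleftrightarrow> (\<forall>j<l. w (i - l + j) = w (i + j))"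
    using True by (auto simp: suffix_iff_drop list_eq_iff_nth_eq)
  also have "\<dots> \<longleftrightarrow> local_shift w i l"
  proof
    assume H: "\<forall>j<l. w (i - l + j) = w (i + j)"
    have "w j = w (j + l)" if "j < i" "i \<le> j + l" for j
      using H[rule_format, of "j + l - i"] that True by simp
    then show "local_shift w i l"
      using assms by (simp add: local_shift_def)
  next
    assume H: "local_shift w i l"
    show "\<forall>j<l. w (i - l + j) = w (i + j)"
    proof (intro allI impI)
      fix j assume "j < l"
      then show "w (i - l + j) = w (i + j)"
        using local_shiftD[OF H, of "i - l + j"] True by simp
    qed
  qed
  finally have *: "suffix (map w [i..<i + l]) (map w [0..<i]) \<longleftrightarrow> local_shift w i l" .
  have "suffix (map w [0..<i]) (map w [i..<i + l]) \<Longrightarrow> suffix (map w [i..<i + l]) (map w [0..<i])"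
    using True by (auto simp: suffix_iff_drop)
  with * show ?thesis by blast
next
  case False
  then have "suffix (map w [0..<i]) (map w [i..<i + l]) \<longleftrightarrow> (\<forall>j<i. w (l + j) = w j)"
    by (auto simp: suffix_iff_drop list_eq_iff_nth_eq)
  also have "\<dots> \<longleftrightarrow> local_shift w i l"
    using False assms by (auto simp: local_shift_def add.commute)
  finally show ?thesis
    using False by (auto simp: suffix_iff_drop)
qed

lemma periodicity_eq_Inf: "periodicity w i = Inf (enat ` {l. local_shift w i l})"
proof -
  have "{enat (length u) | u l. u = map w [i..<i + l] \<and> u \<noteq> [] \<and>
      (suffix u (map w [0..<i]) \<or> suffix (map w [0..<i]) u)} = enat ` {l. local_shift w i l}"
    (is "?A = ?B")
  proof (intro equalityI subsetI)
    fix x assume "x \<in> ?A"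
    then obtain l where l: "x = enat l" "l \<ge> 1"
      "suffix (map w [i..<i + l]) (map w [0..<i]) \<or> suffix (map w [0..<i]) (map w [i..<i + l])"
      by (auto simp: Suc_le_eq)
    then show "x \<in> ?B"
      using suffix_either_iff_local_shift by blast
  next
    fix x assume "x \<in> ?B"
    then obtain l where l: "x = enat l" "local_shift w i l"
      by auto
    moreover from l have "l \<ge> 1"
      by (simp add: local_shift_def)
    ultimately show "x \<in> ?A"
      using suffix_either_iff_local_shift[of l w i]
      by (auto intro!: exI[of _ "map w [i..<i + l]"])
  qed
  then show ?thesis
    by (simp add: periodicity_def)
qed

lemma periodicity_le: "local_shift w i l \<Longrightarrow> periodicity w i \<le> enat l"
  by (auto simp: periodicity_eq_Inf intro: Inf_lower)

lemma le_periodicity: "(\<And>l. local_shift w i l \<Longrightarrow> m \<le> l) \<Longrightarrow> enat m \<le> periodicity w i"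
  by (auto simp: periodicity_eq_Inf intro: Inf_greatest)

section \<open>Binary digits and the Thue-Morse recursion\<close>

lemma finite_bits_nat: "finite {k. bit (n::nat) k}"
proof (rule finite_subset)
  show "{k. bit n k} \<subseteq> {..<n}"
  proof
    fix k assume "k \<in> {k. bit n k}"
    then have "n div 2 ^ k \<noteq> 0"
      by (auto simp: bit_iff_odd intro: odd_pos)
    then have "2 ^ k \<le> n"
      by (simp add: div_eq_0_iff not_less)
    then show "k \<in> {..<n}"
      using order_less_le_trans[OF less_exp[of k]] by simp
  qed
qed simp

text \<open>Appending the digit 0 only shifts the bits. Together with
  \<open>thue_morse_Suc_double\<close> this says that the word is fixed by the morphism 0 -> 01, 1
  -> 10, whose images form blocks starting at even positions.\<close>

lemma thue_morse_double [simp]: "thue_morse (2 * n) = thue_morse n"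
proof -
  have "{k. bit (2 * n) k} = Suc ` {k. bit n k}"
    by (auto simp: image_iff bit_double_iff gr0_conv_Suc)
  then show ?thesis
    by (simp add: thue_morse_def card_image)
qed

lemma thue_morse_Suc_double [simp]: "thue_morse (Suc (2 * n)) = 1 - thue_morse n"
proof -
  have "{k. bit (Suc (2 * n)) k} = insert 0 (Suc ` {k. bit n k})"
  proof (rule set_eqI)
    fix k show "k \<in> {k. bit (Suc (2 * n)) k} \<longleftrightarrow> k \<in> insert 0 (Suc ` {k. bit n k})"
      by (cases k) (auto simp: bit_0 bit_Suc)
  qed
  then show ?thesis
    by (simp add: thue_morse_def card_image finite_bits_nat)
qed

lemma thue_morse_cases: "thue_morse n = 0 \<or> thue_morse n = 1"
  by (simp add: thue_morse_def)

lemma thue_morse_le_1: "thue_morse n \<le> 1"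
  using thue_morse_cases[of n] by auto

lemma thue_morse_Suc_even_neq: "even n \<Longrightarrow> thue_morse (Suc n) \<noteq> thue_morse n"
  by (elim evenE) (use thue_morse_cases[of "n div 2"] in auto)

text \<open>Of the two adjacent pairs, one starts at an even position and is therefore a block with
  distinct letters.\<close>

lemma thue_morse_no_cube_letter:
  "\<not> (thue_morse n = thue_morse (Suc n) \<and> thue_morse (Suc n) = thue_morse (Suc (Suc n)))"
  using thue_morse_Suc_even_neq[of n] thue_morse_Suc_even_neq[of "Suc n"] by (cases "even n") auto

text \<open>The prefix 01 recurs at position 3; each application of the morphism doubles both its
  length and the distance.\<close>

lemma thue_morse_shift_3_power:
  "j < 2 * 2 ^ k \<Longrightarrow> thue_morse (j + 3 * 2 ^ k) = thue_morse j"
proof (induction k arbitrary: j)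
  case 0
  have "thue_morse 3 = thue_morse 0" "thue_morse 4 = thue_morse 1"
    using thue_morse_Suc_double[of 1] thue_morse_Suc_double[of 0] thue_morse_double[of 2]
      thue_morse_double[of 1] thue_morse_cases[of 0]
    by (auto simp: numeral_3_eq_3)
  moreover have "j = 0 \<or> j = 1"
    using 0 by auto
  ultimately show ?case
    by auto
next
  case (Suc k)
  show ?case
  proof (cases "even j")
    case True
    then obtain m where m: "j = 2 * m" ..
    have "j + 3 * 2 ^ Suc k = 2 * (m + 3 * 2 ^ k)"
      using m by simp
    then show ?thesis
      using Suc.IH[of m] Suc.prems m by (simp only: thue_morse_double) simp
  next
    case False
    then obtain m where m: "j = Suc (2 * m)"
      by (auto elim: oddE)
    have "j + 3 * 2 ^ Suc k = Suc (2 * (m + 3 * 2 ^ k))"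
      using m by simp
    then show ?thesis
      using Suc.IH[of m] Suc.prems m by (simp only: thue_morse_Suc_double) simp
  qed
qed

section \<open>Local shifts of the Thue-Morse word\<close>

lemma local_shift_thue_morse_3_power:
  "i \<le> 2 * 2 ^ k \<Longrightarrow> local_shift thue_morse i (3 * 2 ^ k)"
  by (auto simp: local_shift_def thue_morse_shift_3_power Suc_le_eq)

text \<open>The cut before \<open>2 * i + 1\<close> splits the block of \<open>i\<close>. Second
  letters of blocks see it as the cut before \<open>i\<close>, first letters as the cut before
  \<open>Suc i\<close>.\<close>

lemma local_shift_thue_morse_halve:
  assumes "local_shift thue_morse (Suc (2 * i)) (2 * l)"
  shows "local_shift thue_morse i l" "local_shift thue_morse (Suc i) l"
proof -
  have "l \<ge> 1"
    using assms by (auto simp: local_shift_def)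
  moreover have "thue_morse j = thue_morse (j + l)" if "j < i" "i \<le> j + l" for j
  proof -
    have "thue_morse (Suc (2 * (j + l))) = thue_morse (Suc (2 * j))"
      using local_shiftD[OF assms, of "Suc (2 * j)"] that by (simp add: algebra_simps)
    then show ?thesis
      using thue_morse_le_1[of j] thue_morse_le_1[of "j + l"]
      by (simp only: thue_morse_Suc_double)
  qed
  moreover have "thue_morse j = thue_morse (j + l)" if "j < Suc i" "Suc i \<le> j + l" for j
  proof -
    have "thue_morse (2 * (j + l)) = thue_morse (2 * j)"
      using local_shiftD[OF assms, of "2 * j"] that by (simp add: algebra_simps)
    then show ?thesis
      by (simp only: thue_morse_double)
  qed
  ultimately show "local_shift thue_morse i l" "local_shift thue_morse (Suc i) l"
    by (simp_all add: local_shift_def)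
qed

lemma not_local_shift_thue_morse_1:
  "odd i \<Longrightarrow> \<not> local_shift thue_morse i 1"
  using local_shiftD[of thue_morse i 1 "i - 1"] thue_morse_Suc_even_neq[of "i - 1"] odd_pos[of i]
  by auto

text \<open>Three consecutive blocks and the shift together would make the letters at
  \<open>i - 3\<close>, \<open>i - 2\<close> and \<open>i - 1\<close> pairwise distinct, which is
  impossible over two letters.\<close>

lemma not_local_shift_thue_morse_3:
  assumes "odd i" "i \<ge> 3"
  shows "\<not> local_shift thue_morse i 3"
proof
  assume H: "local_shift thue_morse i 3"
  define a where "a = i - 3"
  have i: "i = a + 3" and even_a: "even a" "even (a + 2)" "even (a + 4)"
    using assms by (auto simp: a_def)
  have "thue_morse (a + 3) = thue_morse a" "thue_morse (a + 4) = thue_morse (a + 1)"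
    "thue_morse (a + 5) = thue_morse (a + 2)"
    using local_shiftD[OF H, of a] local_shiftD[OF H, of "a + 1"] local_shiftD[OF H, of "a + 2"] i
    by (simp_all add: algebra_simps)
  moreover have "thue_morse (a + 1) \<noteq> thue_morse a" "thue_morse (a + 3) \<noteq> thue_morse (a + 2)"
    "thue_morse (a + 5) \<noteq> thue_morse (a + 4)"
    using even_a[THEN thue_morse_Suc_even_neq] by (simp_all add: numeral_eq_Suc)
  ultimately show False
    using thue_morse_cases[of a] thue_morse_cases[of "a + 1"] thue_morse_cases[of "a + 2"]
    by auto
qed

lemma not_local_shift_thue_morse_odd:
  assumes "odd i" "i \<ge> 5" "odd l" "l \<ge> 5"
  shows "\<not> local_shift thue_morse i l"
proof
  assume H: "local_shift thue_morse i l"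
  \<comment> \<open>The five positions before \<open>i\<close> are then \<open>2 * a\<close> to
    \<open>2 * a + 4\<close>.\<close>
  define a where "a = (i - 5) div 2"
  have i: "i = 2 * a + 5"
    using assms by (auto simp: a_def elim!: oddE)
  \<comment> \<open>The odd shift carries the pair \<open>j\<close>, \<open>Suc j\<close>, which
    lies across two blocks, onto a single block.\<close>
  have neq: "thue_morse (Suc j) \<noteq> thue_morse j" if "odd j" "i \<le> j + 4" "Suc j < i" for j
    using local_shiftD[OF H, of j] local_shiftD[OF H, of "Suc j"] that assms
      thue_morse_Suc_even_neq[of "j + l"]
    by simp
  have "thue_morse (Suc (Suc (2 * b))) = thue_morse (2 * b)"
    if "thue_morse (Suc (Suc (2 * b))) \<noteq> thue_morse (Suc (2 * b))" for b
    using that thue_morse_Suc_even_neq[of "2 * b"] thue_morse_cases[of "Suc (Suc (2 * b))"]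
      thue_morse_cases[of "Suc (2 * b)"] thue_morse_cases[of "2 * b"]
    by fastforce
  then have *: "thue_morse (Suc b) = thue_morse b"
    if "thue_morse (Suc (Suc (2 * b))) \<noteq> thue_morse (Suc (2 * b))" for b
    using that thue_morse_double[of "Suc b"] by (metis mult_Suc_right add_2_eq_Suc thue_morse_double)
  \<comment> \<open>Alternation gives equal letters at \<open>2 * a\<close>,
    \<open>2 * a + 2\<close> and \<open>2 * a + 4\<close>; halving turns this into three equal
    consecutive letters from \<open>a\<close> on.\<close>
  have "thue_morse (Suc a) = thue_morse a"
    using i by (intro * neq) simp_all
  moreover have "thue_morse (Suc (Suc a)) = thue_morse (Suc a)"
    using i by (intro * neq) simp_all
  ultimately show False
    using thue_morse_no_cube_letter[of a] by simp
qed

lemma local_shift_thue_morse_odd_ge: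
  assumes "odd i" "2 ^ k \<le> i" "local_shift thue_morse i l"
  shows "3 * 2 ^ k \<le> l"
  using assms
proof (induction k arbitrary: i l)
  case 0
  have "l \<noteq> 1"
    using 0 not_local_shift_thue_morse_1 by blast
  moreover have "l \<noteq> 2"
  proof
    assume l: "l = 2"
    obtain m where "i = Suc (2 * m)"
      using 0 by (auto elim: oddE)
    then have "local_shift thue_morse m 1" "local_shift thue_morse (Suc m) 1"
      using 0 l local_shift_thue_morse_halve[of m 1] by simp_all
    then show False
      using not_local_shift_thue_morse_1[of m] not_local_shift_thue_morse_1[of "Suc m"] by auto
  qed
  moreover have "l \<ge> 1"
    using 0 by (simp add: local_shift_def)
  ultimately show ?case
    by simp
next
  case (Suc k)
  obtain m where m: "i = Suc (2 * m)"
    using Suc.prems by (auto elim: oddE)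
  have "m \<ge> 2 ^ k"
    using Suc.prems(2) m by simp
  show ?case
  proof (cases "even l")
    case True
    then obtain l' where l: "l = 2 * l'" ..
    note halve = local_shift_thue_morse_halve[OF Suc.prems(3)[unfolded m l]]
    \<comment> \<open>The induction hypothesis applies at whichever of \<open>m\<close> and
      \<open>Suc m\<close> is odd.\<close>
    have "3 * 2 ^ k \<le> l'"
    proof (cases "odd m")
      case True
      then show ?thesis
        using Suc.IH halve \<open>m \<ge> 2 ^ k\<close> by blast
    next
      case False
      then show ?thesis
        using Suc.IH[of "Suc m"] halve \<open>m \<ge> 2 ^ k\<close> by simp
    qed
    then show ?thesis
      using l by simp
  next
    case False
    have "l \<noteq> 1"
      using Suc.prems not_local_shift_thue_morse_1 by blast
    have "i \<ge> 3"
      using m \<open>m \<ge> 2 ^ k\<close> by (cases m) auto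
    then have "l \<noteq> 3"
      using Suc.prems not_local_shift_thue_morse_3 by blast
    with \<open>l \<noteq> 1\<close> False have "l \<ge> 5"
      by presburger
    then have "\<not> i \<ge> 5"
      using Suc.prems False not_local_shift_thue_morse_odd by blast
    with \<open>i \<ge> 3\<close> Suc.prems have i: "i = 3"
      by presburger
    \<comment> \<open>Before \<open>i = 3\<close> there is no room for five positions, so the last
      odd shift below 6 is refuted by explicit letters.\<close>
    have "l \<noteq> 5"
    proof
      assume "l = 5"
      then have "thue_morse 6 = thue_morse 1"
        using local_shiftD[OF Suc.prems(3), of 1] i by simp
      moreover have "thue_morse 6 = thue_morse 3" "thue_morse 3 = 1 - thue_morse 1"
        using thue_morse_double[of 3] thue_morse_Suc_double[of 1] by (simp, simp add: numeral_3_eq_3)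
      ultimately show False
        using thue_morse_cases[of 1] by auto
    qed
    with \<open>l \<ge> 5\<close> have "l \<ge> 6"
      by simp
    moreover have "k = 0"
      using i m \<open>m \<ge> 2 ^ k\<close> order_less_le_trans[OF less_exp[of k], of m] by simp
    ultimately show ?thesis
      by simp
  qed
qed

section \<open>Periodicity at odd and even positions\<close>

lemma periodicity_thue_morse_odd:
  assumes "odd i" "2 ^ k \<le> i" "i < 2 * 2 ^ k"
  shows "periodicity thue_morse i = enat (3 * 2 ^ k)"
proof (rule antisym)
  show "periodicity thue_morse i \<le> enat (3 * 2 ^ k)"
    using assms by (intro periodicity_le local_shift_thue_morse_3_power) simp
  show "enat (3 * 2 ^ k) \<le> periodicity thue_morse i"
    using assms by (intro le_periodicity local_shift_thue_morse_odd_ge)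
qed

text \<open>If shift 1 fails, the cut lies between two blocks with distinct letters across it, so
  the four letters around it alternate and shift 2 works.\<close>

lemma periodicity_thue_morse_even_le:
  assumes "even i"
  shows "periodicity thue_morse i \<le> enat 2"
proof (cases "local_shift thue_morse i 1")
  case True
  then have "periodicity thue_morse i \<le> enat 1"
    by (rule periodicity_le)
  also have "\<dots> \<le> enat 2"
    by simp
  finally show ?thesis .
next
  case False
  then obtain j where j: "j < i" "i \<le> j + 1" "thue_morse (j + 1) \<noteq> thue_morse j"
    by (auto simp: local_shift_def)
  then have "i = Suc j"
    by simp
  with assms obtain a where i: "i = Suc (Suc a)" and "even a"
    by (cases j) auto
  have neq: "thue_morse (a + 2) \<noteq> thue_morse (a + 1)"
    using j \<open>i = Suc j\<close> i by simp
  have "thue_morse (a + 2) = thue_morse a" "thue_morse (a + 3) = thue_morse (a + 1)"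
    using neq i thue_morse_Suc_even_neq[OF \<open>even a\<close>] thue_morse_Suc_even_neq[OF assms]
      thue_morse_cases[of a] thue_morse_cases[of "a + 1"] thue_morse_cases[of "a + 2"]
      thue_morse_cases[of "a + 3"]
    by (auto simp: numeral_eq_Suc)
  then have "local_shift thue_morse i 2"
    using i by (auto simp: local_shift_def less_Suc_eq numeral_eq_Suc)
  then show ?thesis
    by (rule periodicity_le)
qed

text \<open>For odd \<open>i\<close> the value \<open>3 * 2 ^ k\<close> is freed of \<open>k\<close>
  by \<open>2 ^ k \<le> i\<close> and \<open>i + 1 \<le> 2 * 2 ^ k\<close>.\<close>

lemma periodicity_thue_morse_bounds:
  obtains P where "\<And>i. periodicity thue_morse i = enat (P i)"
    "\<And>i. even i \<Longrightarrow> 1 \<le> P i \<and> P i \<le> 2"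
    "\<And>i. odd i \<Longrightarrow> 3 * (i + 1) \<le> 2 * P i \<and> P i \<le> 3 * i"
proof -
  have "\<exists>p. periodicity thue_morse i = enat p \<and> (even i \<longrightarrow> 1 \<le> p \<and> p \<le> 2) \<and>
      (odd i \<longrightarrow> 3 * (i + 1) \<le> 2 * p \<and> p \<le> 3 * i)" for i
  proof (cases "even i")
    case True
    obtain p where p: "periodicity thue_morse i = enat p" "p \<le> 2"
      using periodicity_thue_morse_even_le[OF True] by (cases "periodicity thue_morse i") auto
    have "enat 1 \<le> periodicity thue_morse i"
      by (rule le_periodicity) (simp add: local_shift_def)
    with p True show ?thesis
      by auto
  next
    case False
    then obtain k where k: "2 ^ k \<le> i" "i < 2 ^ (k + 1)"
      using ex_power_ivl1[of 2 i] odd_pos[of i] by auto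
    then show ?thesis
      using False periodicity_thue_morse_odd[of i k] by auto
  qed
  then show thesis
    using that by metis
qed

section \<open>Summation and averaging\<close>

lemma sum_alternating_bounds:
  fixes P :: "nat \<Rightarrow> nat"
  assumes even: "\<And>i. even i \<Longrightarrow> 1 \<le> P i \<and> P i \<le> 2"
    and odd: "\<And>i. odd i \<Longrightarrow> 3 * (i + 1) \<le> 2 * P i \<and> P i \<le> 3 * i"
  shows "3 * n * n \<le> 8 * (\<Sum>i<n. P i) + 2 * n" "4 * (\<Sum>i<n. P i) \<le> 3 * n * n + 8 * n"
proof -
  \<comment> \<open>The pair \<open>2 * m\<close>, \<open>2 * m + 1\<close> adds at least
    \<open>3 * m + 4\<close> and at most \<open>6 * m + 5\<close>; both sides are the exact sums of
    these increments, the lower one doubled.\<close>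
  have double: "3 * m * m + 5 * m \<le> 2 * (\<Sum>i<2 * m. P i) \<and> (\<Sum>i<2 * m. P i) \<le> 3 * m * m + 2 * m" for m
  proof (induction m)
    case 0
    show ?case by simp
  next
    case (Suc m)
    have "(\<Sum>i<2 * Suc m. P i) = (\<Sum>i<2 * m. P i) + P (2 * m) + P (Suc (2 * m))"
      by simp
    then show ?case
      using Suc.IH even[of "2 * m"] odd[of "Suc (2 * m)"] by (simp add: algebra_simps)
  qed
  \<comment> \<open>These are the bounds on the average with denominators cleared; for odd
    \<open>n\<close> the unpaired last position is even and adds 1 or 2.\<close>
  have "3 * n * n \<le> 8 * (\<Sum>i<n. P i) + 2 * n \<and> 4 * (\<Sum>i<n. P i) \<le> 3 * n * n + 8 * n"
  proof (cases "even n")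
    case True
    then obtain m where "n = 2 * m" ..
    then show ?thesis
      using double[of m] by (simp add: algebra_simps)
  next
    case False
    then obtain m where n: "n = Suc (2 * m)"
      by (auto elim: oddE)
    then have "(\<Sum>i<n. P i) = (\<Sum>i<2 * m. P i) + P (2 * m)"
      by simp
    then show ?thesis
      using double[of m] even[of "2 * m"] n by (simp add: algebra_simps)
  qed
  then show "3 * n * n \<le> 8 * (\<Sum>i<n. P i) + 2 * n" "4 * (\<Sum>i<n. P i) \<le> 3 * n * n + 8 * n"
    by blast+
qed

text \<open>All periodicities are finite, so the extended-real average is a real number for positive
  \<open>n\<close>.\<close>

lemma periodic_complexity_thue_morse_bounds:
  obtains h where "\<And>n. n \<ge> 1 \<Longrightarrow> periodic_complexity thue_morse n = ereal (h n)"
    "\<And>n. n \<ge> 1 \<Longrightarrow> 3 * real n / 8 - 1 / 4 \<le> h n"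
    "\<And>n. n \<ge> 1 \<Longrightarrow> h n \<le> 3 * real n / 4 + 2"
proof -
  obtain P where P: "\<And>i. periodicity thue_morse i = enat (P i)"
    "\<And>i. even i \<Longrightarrow> 1 \<le> P i \<and> P i \<le> 2"
    "\<And>i. odd i \<Longrightarrow> 3 * (i + 1) \<le> 2 * P i \<and> P i \<le> 3 * i"
    using periodicity_thue_morse_bounds by blast
  define S where "S n = (\<Sum>i<n. P i)" for n
  have "periodic_complexity thue_morse n = ereal (real (S n) / real n)" if "n \<ge> 1" for n
    using that by (simp add: periodic_complexity_def P(1) S_def)
  moreover have "3 * real n / 8 - 1 / 4 \<le> real (S n) / real n" if "n \<ge> 1" for n
  proof -
    have "real (3 * n * n) \<le> real (8 * S n + 2 * n)"
      using sum_alternating_bounds(1)[OF P(2,3)] unfolding S_def of_nat_le_iff .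
    then show ?thesis
      using that by (simp add: field_simps)
  qed
  moreover have "real (S n) / real n \<le> 3 * real n / 4 + 2" if "n \<ge> 1" for n
  proof -
    have "real (4 * S n) \<le> real (3 * n * n + 8 * n)"
      using sum_alternating_bounds(2)[OF P(2,3)] unfolding S_def of_nat_le_iff .
    then show ?thesis
      using that by (simp add: field_simps)
  qed
  ultimately show thesis
    by (rule that)
qed

theorem theorem3:
  shows "(\<forall>n::nat. n \<ge> 1 \<longrightarrow>
            ereal (3 * real n / 8 - 1 / 4) \<le> periodic_complexity thue_morse n \<and>
            periodic_complexity thue_morse n \<le> ereal (3 * real n / 4 + 2))
       \<and> (\<lambda>n::nat. real_of_ereal (periodic_complexity thue_morse n)) \<in> \<Theta>(\<lambda>n. real n)"
proof -
  obtain h where h: "\<And>n. n \<ge> 1 \<Longrightarrow> periodic_complexity thue_morse n = ereal (h n)"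
    "\<And>n. n \<ge> 1 \<Longrightarrow> 3 * real n / 8 - 1 / 4 \<le> h n"
    "\<And>n. n \<ge> 1 \<Longrightarrow> h n \<le> 3 * real n / 4 + 2"
    using periodic_complexity_thue_morse_bounds by blast
  \<comment> \<open>The constants absorb \<open>- 1 / 4\<close> and \<open>+ 2\<close> already from
    \<open>n = 1\<close> on; the lower one is sharp there, as 3/8 - 1/4 = 1/8.\<close>
  have bounds: "1 / 8 * real n \<le> h n" "h n \<le> 3 * real n" if "n \<ge> 1" for n
  proof -
    have "1 \<le> real n"
      using that by simp
    then show "1 / 8 * real n \<le> h n" "h n \<le> 3 * real n"
      using h(2,3)[OF that] by linarith+
  qed
  have "h n \<ge> 0" if "n \<ge> 1" for n
    using bounds(1)[OF that] by (rule order_trans[rotated]) simp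
  then have "(\<lambda>n::nat. real_of_ereal (periodic_complexity thue_morse n)) \<in> \<Theta>(\<lambda>n. real n)"
    using bounds h(1)
    by (intro bigthetaI'[of "1 / 8" 3] eventually_sequentiallyI[of 1]) auto
  then show ?thesis
    using h by auto
qed

end
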